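(* Let $\alpha$ and $\beta$ be integers with $\alpha\neq 1$ and $\beta\neq 1$, and let $$G(\alpha,\beta)=\langle A,B\mid A^{[A,B]}=A^{\alpha},\ B^{[B,A]}=B^{\beta}\rangle .$$ Then the group $G(\alpha,\beta)$ is nilpotent.
   Context: Conventions: $[x,y]=x^{-1}y^{-1}xy$ and $y^x=x^{-1}yx$, so $A^{[A,B]}=[A,B]^{-1}A[A,B]$. *)

theory Defs
  imports "HOL-Algebra.Algebra"
begin

text \<open>Lower central series: gamma_0 = G, gamma_(n+1) = [G, gamma_n], the subgroup
  generated by all commutators x y x^-1 y^-1 with x in G and y in gamma_n.
  (The choice of commutator convention does not affect the subgroup generated.)\<close>

primrec lower_central :: "('a, 'b) monoid_scheme \<Rightarrow> nat \<Rightarrow> 'a set" where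
  "lower_central G 0 = carrier G"
| "lower_central G (Suc n) =
     generate G (\<Union>x \<in> carrier G. \<Union>y \<in> lower_central G n.
        {x \<otimes>\<^bsub>G\<^esub> y \<otimes>\<^bsub>G\<^esub> inv\<^bsub>G\<^esub> x \<otimes>\<^bsub>G\<^esub> inv\<^bsub>G\<^esub> y})"

definition nilpotent :: "('a, 'b) monoid_scheme \<Rightarrow> bool" where
  "nilpotent G \<longleftrightarrow> group G \<and> (\<exists>n. lower_central G n = {\<one>\<^bsub>G\<^esub>})"

datatype gen = GA | GB

text \<open>A letter is a generator together with a flag: True means the inverse of the generator.\<close>
type_synonym letter = "gen \<times> bool"
type_synonym word = "letter list"

definition flip :: "letter \<Rightarrow> letter" where
  "flip x = (fst x, \<not> snd x)"

definition winv :: "word \<Rightarrow> word" where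
  "winv w = rev (map flip w)"

definition wpow :: "letter \<Rightarrow> int \<Rightarrow> word" where
  "wpow x k = (if 0 \<le> k then replicate (nat k) x else replicate (nat (- k)) (flip x))"

inductive pres_eq :: "word set \<Rightarrow> word \<Rightarrow> word \<Rightarrow> bool" for R where
  refl: "pres_eq R w w"
| sym: "pres_eq R u v \<Longrightarrow> pres_eq R v u"
| trans: "pres_eq R u v \<Longrightarrow> pres_eq R v w \<Longrightarrow> pres_eq R u w"
| cancel: "pres_eq R (u @ [x, flip x] @ v) (u @ v)"
| relator: "r \<in> R \<Longrightarrow> pres_eq R (u @ r @ v) (u @ v)"

definition pres_cls :: "word set \<Rightarrow> word \<Rightarrow> word set" where
  "pres_cls R w = {v. pres_eq R w v}"

definition presented_group :: "word set \<Rightarrow> word set monoid" where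
  "presented_group R =
     \<lparr> carrier = range (pres_cls R),
       monoid.mult = (\<lambda>S T. pres_cls R ((SOME u. u \<in> S) @ (SOME v. v \<in> T))),
       one = pres_cls R [] \<rparr>"

abbreviation (input) "lA \<equiv> (GA, False)"
abbreviation (input) "lB \<equiv> (GB, False)"

text \<open>Conventions: [x,y] = x^-1 y^-1 x y and y^x = x^-1 y x.
  Relator 1: [A,B]^-1 A [A,B] A^(-alpha)   (i.e. A^[A,B] = A^alpha)
  Relator 2: [B,A]^-1 B [B,A] B^(-beta)    (i.e. B^[B,A] = B^beta)\<close>

definition comm_word :: "letter \<Rightarrow> letter \<Rightarrow> word" where
  "comm_word x y = [flip x, flip y, x, y]"

definition G_rels :: "int \<Rightarrow> int \<Rightarrow> word set" where
  "G_rels \<alpha> \<beta> =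
     { winv (comm_word lA lB) @ [lA] @ comm_word lA lB @ wpow lA (- \<alpha>),
       winv (comm_word lB lA) @ [lB] @ comm_word lB lA @ wpow lB (- \<beta>) }"

definition G_ab :: "int \<Rightarrow> int \<Rightarrow> word set monoid" where
  "G_ab \<alpha> \<beta> = presented_group (G_rels \<alpha> \<beta>)"

end

theory Submission
  imports Defs "HOL-Number_Theory.Number_Theory"
begin

text \<open>
  With \<open>C = [A,B]\<close> the relations read \<open>AC = CA\<^sup>\<alpha>\<close>, \<open>CB = B\<^sup>\<beta>C\<close>, \<open>AB = BAC\<close>; they are preserved
  by exchanging A with B and C with its inverse. They give \<open>A\<^sup>nB = BC\<^sup>nA\<^sup>T\<close> where T is
  \<open>\<alpha> + \<dots> + \<alpha>\<^sup>n\<close>, and computing the conjugate of \<open>A [^] \<alpha>\<^sup>2\<close> by B in two ways yields a relation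
  between A, B and C from which A and B have finite order when \<open>\<alpha>, \<beta> \<noteq> 1\<close>.

  Suppose \<open>A\<^sup>n = B\<^sup>n = 1\<close> and \<open>n = pm\<close> with p the largest prime divisor of n. Then \<open>C\<^sup>n\<close> is a power of A
  and also a power of B, hence central. Modulo \<open>C\<^sup>n\<close>, the element \<open>C\<^sup>m\<close> is central, because the order of
  \<open>\<alpha>\<close> modulo the order of A divides m. Modulo \<open>C\<^sup>m\<close>, the elements \<open>A\<^sup>m\<close> and \<open>B\<^sup>m\<close> are central,
  because T (for m in place of n) is congruent to m or to 0 modulo the order of A.
  Induction on n gives a central series.
\<close>

section \<open>Sums of powers\<close>

text \<open>The summation starts at 1 because the value serves as the exponent of A in
  \<open>(A \<otimes> C) [^] n\<close>.\<close>

definition power_sum :: "int \<Rightarrow> nat \<Rightarrow> int" where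
  "power_sum x n = (\<Sum>i=1..n. x ^ i)"

lemma power_sum_0 [simp]: "power_sum x 0 = 0"
  by (simp add: power_sum_def)

text \<open>Horner form, matching the collection of words: a further factor
  \<open>A \<otimes> C\<close> adds one to the exponent of A, and moving past C then multiplies it
  by \<alpha>.\<close>

lemma power_sum_Suc: "power_sum x (Suc n) = x * (power_sum x n + 1)"
proof (induction n)
  case (Suc n)
  have step: "power_sum x (Suc k) = power_sum x k + x ^ Suc k" for k
    by (simp add: power_sum_def)
  have "power_sum x (Suc (Suc n)) = x * (power_sum x n + 1) + x * x ^ Suc n"
    by (simp only: step[of "Suc n"] Suc.IH power_Suc)
  also have "\<dots> = x * (power_sum x (Suc n) + 1)"
    by (simp only: step[of n] ring_distribs ac_simps)
  finally show ?case .
qed (simp add: power_sum_def)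

lemma power_sum_add: "power_sum x (m + n) = power_sum x m + x ^ m * power_sum x n"
  by (induction m) (simp_all add: power_sum_Suc algebra_simps)

text \<open>Cut the m * q summands into q blocks of length m; block j is the first one scaled by
  \<open>(x ^ m) ^ j\<close>.\<close>

lemma power_sum_mult: "power_sum x (m * q) = power_sum x m * (\<Sum>j<q. (x ^ m) ^ j)"
proof (induction q)
  case (Suc q)
  have "power_sum x (m * Suc q) = power_sum x (m * q) + x ^ (m * q) * power_sum x m"
    using power_sum_add[of x "m * q" m] by (simp add: add.commute)
  then show ?case using Suc by (simp add: power_mult algebra_simps)
qed simp

lemma power_sum_telescope: "(x - 1) * power_sum x n = x * (x ^ n - 1)"
  by (induction n) (simp_all add: power_sum_Suc algebra_simps)

section \<open>Power sums modulo powers of a divisor of x - 1\<close>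

lemma dvd_power_minus_one: "(q::int) dvd x - 1 \<Longrightarrow> q dvd x ^ n - 1"
  by (metis dvd_trans power_diff_1_eq dvd_triv_left)

text \<open>Each factor q split off m contributes a sum of q powers of x. All of these are congruent
  to 1 modulo q, so their sum is divisible by q.\<close>

lemma power_dvd_power_sum:
  fixes x :: int and q :: nat
  assumes "int q dvd x - 1" "q > 0"
  shows "q ^ k dvd m \<Longrightarrow> int (q ^ k) dvd power_sum x m"
proof (induction k arbitrary: m)
  case (Suc k)
  then obtain w where w: "m = q ^ Suc k * w" by blast
  define m0 where "m0 = q ^ k * w"
  have m: "m = m0 * q" by (simp add: w m0_def)
  have IH: "int (q ^ k) dvd power_sum x m0" by (rule Suc.IH) (simp add: m0_def)
  have "int q dvd (\<Sum>j<q. (x ^ m0) ^ j - 1)"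
    using assms by (intro dvd_sum dvd_power_minus_one)
  then have "int q dvd (\<Sum>j<q. (x ^ m0) ^ j) - int q"
    by (simp add: sum_subtractf)
  then have "int q dvd (\<Sum>j<q. (x ^ m0) ^ j)"
    by (metis dvd_diff_commute dvd_refl dvd_add_right_iff uminus_add_conv_diff dvd_minus_iff)
  then show ?case unfolding m power_sum_mult power_Suc2 of_nat_mult by (rule mult_dvd_mono[OF IH])
qed simp

text \<open>The binomial expansion cut off after its linear term.\<close>

lemma dvd_power_minus_linear:
  fixes q s :: int
  shows "q\<^sup>2 dvd (1 + q * s) ^ j - 1 - int j * (q * s)"
proof (induction j)
  case (Suc j)
  then obtain r where r: "(1 + q * s) ^ j = 1 + int j * (q * s) + q\<^sup>2 * r"
    by (auto simp: dvd_def algebra_simps)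
  have "(1 + q * s) ^ Suc j - 1 - int (Suc j) * (q * s) = q\<^sup>2 * (r * (1 + q * s) + int j * s\<^sup>2)"
    by (simp add: r algebra_simps power2_eq_square)
  then show ?case by (metis dvd_triv_left)
qed simp

text \<open>With y = 1 + p s the linear terms add up to p s times p (p - 1) / 2, a multiple of p^2
  because (p - 1) / 2 is an integer.\<close>

lemma odd_dvd_sum_powers:
  fixes y :: int and p :: nat
  assumes "int p dvd y - 1" "odd p"
  shows "(int p)\<^sup>2 dvd (\<Sum>j<p. y ^ j) - int p"
proof -
  obtain s where s: "y = 1 + int p * s" using assms(1) by (auto simp: dvd_def algebra_simps)
  have "(int p)\<^sup>2 dvd (\<Sum>j<p. y ^ j - 1 - int j * (int p * s))"
    unfolding s by (intro dvd_sum dvd_power_minus_linear)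
  also have "(\<Sum>j<p. y ^ j - 1 - int j * (int p * s))
    = (\<Sum>j<p. y ^ j) - int p - (\<Sum>j<p. int j) * (int p * s)"
    by (simp add: sum_subtractf sum_distrib_right)
  finally have 1: "(int p)\<^sup>2 dvd (\<Sum>j<p. y ^ j) - int p - (\<Sum>j<p. int j) * (int p * s)" .
  obtain r where r: "p = 2 * r + 1" using assms(2) by (auto elim: oddE)
  have "(\<Sum>j<2 * r + 1. int j) = int (2 * r + 1) * int r"
    by (induction r) (simp_all add: algebra_simps)
  then have "(\<Sum>j<p. int j) * (int p * s) = (int p)\<^sup>2 * (int r * s)"
    by (simp add: r power2_eq_square)
  then have "(int p)\<^sup>2 dvd (\<Sum>j<p. int j) * (int p * s)" by (metis dvd_triv_left)
  with 1 show ?thesis by (metis dvd_diffD1 dvd_diff_commute diff_add_cancel dvd_add)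
qed

text \<open>Each factor p of m multiplies the sum by a number congruent to p modulo p^2, so the
  precision grows by one power of p. The exponent \<open>Suc k\<close> makes up for the factor p by
  which m falls short of n in \<open>power_sum_cofactor\<close>.\<close>

lemma odd_power_dvd_power_sum_minus:
  fixes x :: int and p :: nat
  assumes "int p dvd x - 1" "odd p"
  shows "p ^ k dvd m \<Longrightarrow> int (p ^ Suc k) dvd power_sum x m - int m"
proof (induction k arbitrary: m)
  case 0
  have "int p dvd (\<Sum>i=1..m. x ^ i - 1)"
    using assms by (intro dvd_sum dvd_power_minus_one)
  then show ?case by (simp add: sum_subtractf power_sum_def)
next
  case (Suc k)
  then obtain w where w: "m = p ^ Suc k * w" by blast
  define m0 where "m0 = p ^ k * w"
  have m: "m = m0 * p" by (simp add: w m0_def)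
  have "int (p ^ Suc k) dvd power_sum x m0 - int m0" by (rule Suc.IH) (simp add: m0_def)
  then obtain u where u: "power_sum x m0 = int m0 + int (p ^ Suc k) * u"
    by (auto simp: dvd_def algebra_simps)
  have "(int p)\<^sup>2 dvd (\<Sum>j<p. (x ^ m0) ^ j) - int p"
    using assms by (intro odd_dvd_sum_powers dvd_power_minus_one)
  then obtain v where v: "(\<Sum>j<p. (x ^ m0) ^ j) = int p + (int p)\<^sup>2 * v"
    by (auto simp: dvd_def algebra_simps)
  have "power_sum x m - int m = int (p ^ Suc (Suc k)) * (u + int p * u * v + int w * v)"
    unfolding m power_sum_mult u v by (simp add: m0_def algebra_simps power2_eq_square)
  then show ?case by (metis dvd_triv_left)
qed

section \<open>Multiplicative orders and the largest prime divisor\<close>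

lemma int_dvd_if_prime_powers_dvd:
  fixes g :: nat and y :: int
  assumes "g > 0" and "\<And>q e. Factorial_Ring.prime q \<Longrightarrow> e > 0 \<Longrightarrow> q ^ e dvd g \<Longrightarrow> int (q ^ e) dvd y"
  shows "int g dvd y"
proof -
  have "g dvd nat \<bar>y\<bar>"
  proof (cases "y = 0")
    case False
    show ?thesis
    proof (rule multiplicity_le_imp_dvd)
      show "multiplicity q g \<le> multiplicity q (nat \<bar>y\<bar>)" if q: "Factorial_Ring.prime q" for q
      proof (cases "multiplicity q g = 0")
        case ne: False
        have "int (q ^ multiplicity q g) dvd y"
          using assms(2)[OF q, of "multiplicity q g"] ne by (simp add: multiplicity_dvd)
        then have "q ^ multiplicity q g dvd nat \<bar>y\<bar>"
          by (metis int_dvd_int_iff dvd_abs_iff abs_ge_zero int_nat_eq)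
        then show ?thesis using False q
          by (intro multiplicity_geI) (auto simp: prime_nat_iff)
      qed simp
    qed (use assms(1) in simp)
  qed simp
  then show ?thesis by (metis int_dvd_int_iff dvd_abs_iff abs_ge_zero int_nat_eq)
qed

text \<open>Here d stands for a multiplicative order modulo \<open>q ^ e\<close>, which divides the
  totient \<open>q ^ (e - 1) * (q - 1)\<close>. If q differs from p, this totient is prime to p,
  hence so is d. If q = p, the gcd of the totient and p * m already divides m.\<close>

lemma dvd_cofactor_largest_prime:
  fixes d p q m e :: nat
  assumes p: "Factorial_Ring.prime p" and q: "Factorial_Ring.prime q" "q \<le> p" and "e > 0"
    and n: "q ^ e dvd p * m" and d: "d dvd p * m" "d dvd q ^ (e - 1) * (q - 1)"
  shows "d dvd m"
proof -
  \<comment> \<open>Since q \<le> p, the number q - 1 is positive and less than p.\<close>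
  have cop: "coprime p (q - 1)"
    using p q by (metis prime_imp_coprime nat_dvd_not_less prime_gt_1_nat zero_less_diff
        diff_less less_le_trans less_numeral_extra(1) prime_gt_0_nat)
  show ?thesis
  proof (cases "q = p")
    case False
    then have "coprime p q" using p q by (simp add: primes_coprime)
    with cop have "coprime p (q ^ (e - 1) * (q - 1))" by simp
    with d have "coprime p d" by (meson coprime_divisors dvd_refl)
    with d(1) show ?thesis by (simp add: coprime_dvd_mult_right_iff coprime_commute)
  next
    case True
    obtain f where f: "e = Suc f" using \<open>e > 0\<close> by (cases e) auto
    have "p ^ f dvd m" using n p True f by (auto simp: prime_gt_0_nat)
    then obtain w where w: "m = p ^ f * w" by blast
    have "d dvd gcd (p ^ f * (p * w)) (p ^ f * (p - 1))"
      using d True f w by (simp add: ac_simps)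
    also have "\<dots> = p ^ f * gcd w (p - 1)"
      using cop True gcd_mult_left_left_cancel[of "p - 1" p w]
      by (simp add: gcd_mult_distrib_nat[symmetric] coprime_commute)
    also have "\<dots> dvd m" using w by simp
    finally show ?thesis .
  qed
qed

text \<open>Modulo each prime power dividing g, the order of x divides both n and the totient, hence
  m by \<open>dvd_cofactor_largest_prime\<close>.\<close>

lemma dvd_power_minus_one_cofactor:
  fixes x :: int and n m p g :: nat
  assumes p: "Factorial_Ring.prime p" and max: "\<And>q. Factorial_Ring.prime q \<Longrightarrow> q dvd n \<Longrightarrow> q \<le> p"
    and n: "n = p * m" "n > 0" and g: "g dvd n" "int g dvd x ^ n - 1"
  shows "int g dvd x ^ m - 1"
proof (rule int_dvd_if_prime_powers_dvd)
  show "g > 0" using g n by (metis dvd_0_left_iff neq0_conv)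
  fix q e assume q: "Factorial_Ring.prime q" "e > 0" "q ^ e dvd g"
  define M where "M = q ^ e"
  have M: "M > 0" using q by (simp add: M_def prime_gt_0_nat)
  \<comment> \<open>The multiplicative order \<open>ord\<close> is taken of a natural number, so x
    is replaced by its residue.\<close>
  define a where "a = nat (x mod int M)"
  have a: "[x = int a] (mod int M)" using M by (simp add: a_def cong_def)
  have iff: "int M dvd x ^ k - 1 \<longleftrightarrow> [a ^ k = 1] (mod M)" for k
  proof -
    have "int M dvd x ^ k - 1 \<longleftrightarrow> [x ^ k = 1] (mod int M)" by (simp add: cong_iff_dvd_diff)
    also have "\<dots> \<longleftrightarrow> [int a ^ k = 1] (mod int M)"
      using cong_pow[OF a, of k] by (meson cong_sym cong_trans)
    also have "\<dots> \<longleftrightarrow> [a ^ k = 1] (mod M)" by (metis cong_int_iff of_nat_1 of_nat_power)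
    finally show ?thesis .
  qed
  have "int M dvd x ^ n - 1" using q g unfolding M_def by (meson dvd_trans int_dvd_int_iff)
  then have 1: "[a ^ n = 1] (mod M)" by (simp add: iff)
  then have cop: "coprime M a"
    by (metis coprime_commute coprime_power_left_iff cong_imp_coprime cong_sym coprime_1_left n(2) neq0_conv)
  have "ord M a dvd n" using 1 by (simp only: ord_divides)
  moreover have "ord M a dvd totient M" using cop by (rule order_divides_totient)
  then have "ord M a dvd q ^ (e - 1) * (q - 1)" using q by (simp add: M_def totient_prime_power)
  moreover have "q ^ e dvd n" "q dvd n"
    using q g by (meson dvd_trans dvd_power)+
  ultimately have "ord M a dvd m"
    using q p max n dvd_cofactor_largest_prime[of p q e m "ord M a"] by auto
  then show "int (q ^ e) dvd x ^ m - 1" by (simp only: iff ord_divides flip: M_def)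
qed

text \<open>If p does not divide x - 1, the sum vanishes modulo every prime power dividing g. If it
  does and p is odd, the sum is congruent to m modulo each of them. If it does and p = 2, the sum is
  m * j and g divides 2 * m, so the parity of j decides between the alternatives.\<close>

lemma power_sum_cofactor:
  fixes x :: int and n m p g :: nat
  assumes p: "Factorial_Ring.prime p" and max: "\<And>q. Factorial_Ring.prime q \<Longrightarrow> q dvd n \<Longrightarrow> q \<le> p"
    and n: "n = p * m" "n > 0" and g: "g dvd n" "int g dvd x ^ m - 1"
  shows "int g dvd power_sum x m \<or> int g dvd power_sum x m - int m"
proof -
  have g0: "g > 0" using g n by (metis dvd_0_left_iff neq0_conv)
  \<comment> \<open>If q divides x - 1, then q is not p and \<open>q ^ e\<close> divides m.
    Otherwise x - 1 can be cancelled from the telescoped sum.\<close>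
  have *: "int (q ^ e) dvd power_sum x m"
    if q: "Factorial_Ring.prime q" "q ^ e dvd g" "q \<noteq> p \<or> \<not> int p dvd x - 1" for q e
  proof (cases "int q dvd x - 1")
    case True
    with q have "q \<noteq> p" by auto
    then have "coprime (q ^ e) p" using p q by (simp add: primes_coprime)
    moreover have "q ^ e dvd p * m" using q g n by (metis dvd_trans)
    ultimately have "q ^ e dvd m" by (simp add: coprime_dvd_mult_right_iff)
    then show ?thesis using True q power_dvd_power_sum prime_gt_0_nat by blast
  next
    case False
    then have "coprime (int q ^ e) (x - 1)" using q by (simp add: prime_imp_coprime)
    moreover have "int (q ^ e) dvd x ^ m - 1" using q g by (meson dvd_trans int_dvd_int_iff)
    then have "int (q ^ e) dvd (x - 1) * power_sum x m" by (simp add: power_sum_telescope)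
    ultimately show ?thesis by (simp add: coprime_dvd_mult_right_iff)
  qed
  show ?thesis
  proof (cases "int p dvd x - 1")
    case False
    then have "int g dvd power_sum x m" using * g0 by (blast intro: int_dvd_if_prime_powers_dvd[of g])
    then show ?thesis ..
  next
    case px: True
    show ?thesis
    proof (cases "odd p")
      case True
      have "int g dvd power_sum x m - int m"
      proof (rule int_dvd_if_prime_powers_dvd[OF g0])
        fix q e assume q: "Factorial_Ring.prime q" "e > 0" "q ^ e dvd g"
        have dvd: "q ^ e dvd p * m" using q g n by (metis dvd_trans)
        show "int (q ^ e) dvd power_sum x m - int m"
        proof (cases "q = p")
          case qp: True
          obtain f where f: "e = Suc f" using q by (cases e) auto
          have "p ^ f dvd m" using dvd p qp f by (auto simp: prime_gt_0_nat)
          then show ?thesis using odd_power_dvd_power_sum_minus[OF px True] qp f by blast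
        next
          case False
          then have "coprime (q ^ e) p" using p q by (simp add: primes_coprime)
          with dvd have "q ^ e dvd m" by (simp add: coprime_dvd_mult_right_iff)
          then have "int (q ^ e) dvd int m" by (simp only: int_dvd_int_iff)
          then show ?thesis using * False q by (intro dvd_diff) blast+
        qed
      qed
      then show ?thesis ..
    next
      case False
      then have p2: "p = 2" using p prime_odd_nat prime_ge_2_nat[of p] by force
      \<comment> \<open>As 2 is the largest prime divisor of n, it is the only one.\<close>
      have "int m dvd power_sum x m"
      proof (rule int_dvd_if_prime_powers_dvd)
        fix q e assume q: "Factorial_Ring.prime q" "e > 0" "q ^ e dvd m"
        then have "q dvd n" using n by (meson dvd_mult dvd_power dvd_trans)
        then have "q = p" using max[of q] q p2 prime_ge_2_nat[of q] by auto
        then show "int (q ^ e) dvd power_sum x m"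
          using power_dvd_power_sum[OF px] q p2 by simp
      qed (use n in simp)
      then obtain j where j: "power_sum x m = int m * j" by blast
      have gm: "int g dvd int m * 2" using g n p2 by (metis int_dvd_int_iff mult.commute of_nat_mult of_nat_numeral)
      show ?thesis
      proof (cases "even j")
        case True
        then show ?thesis using gm j by (metis dvd_trans dvd_refl mult_dvd_mono)
      next
        case False
        then have "int m * 2 dvd int m * (j - 1)" by simp
        then show ?thesis using gm j by (metis dvd_trans mult.right_neutral right_diff_distrib)
      qed
    qed
  qed
qed

section \<open>Macdonald relations\<close>

text \<open>The hypothesis \<open>x \<otimes> z = z \<otimes> y\<close> says without inverses that
  conjugation by z takes x to y; conjugation respects powers.\<close>

lemma (in group) nat_pow_intertwine:
  assumes "x \<in> carrier G" "y \<in> carrier G" "z \<in> carrier G" "x \<otimes> z = z \<otimes> y"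
  shows "x [^] (n::nat) \<otimes> z = z \<otimes> y [^] n"
proof (induction n)
  case (Suc n)
  have "x [^] Suc n \<otimes> z = x [^] n \<otimes> (x \<otimes> z)" using assms by (simp add: m_assoc)
  also have "\<dots> = (x [^] n \<otimes> z) \<otimes> y" using assms by (simp add: m_assoc)
  also have "\<dots> = z \<otimes> y [^] Suc n" using assms by (simp add: Suc m_assoc)
  finally show ?case .
qed (use assms in simp)

lemma (in group) inv_intertwine:
  assumes "x \<in> carrier G" "y \<in> carrier G" "z \<in> carrier G" "x \<otimes> z = z \<otimes> y"
  shows "inv x \<otimes> z = z \<otimes> inv y"
proof -
  have "x \<otimes> (z \<otimes> inv y) = z"
    using assms by (simp add: m_assoc[symmetric]) (simp add: m_assoc)
  then show ?thesis using assms by (simp add: inv_solve_left')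
qed

lemma (in group) intertwine_inv:
  assumes "x \<in> carrier G" "y \<in> carrier G" "z \<in> carrier G" "x \<otimes> z = z \<otimes> y"
  shows "inv z \<otimes> x = y \<otimes> inv z"
proof -
  have "z \<otimes> (y \<otimes> inv z) = x \<otimes> z \<otimes> inv z"
    using assms by (simp add: m_assoc[symmetric])
  also have "\<dots> = x" using assms(1-3) by (simp add: m_assoc)
  finally show ?thesis using assms(1-3) by (simp add: inv_solve_left')
qed

lemma (in group) int_pow_intertwine:
  assumes "x \<in> carrier G" "y \<in> carrier G" "z \<in> carrier G" "x \<otimes> z = z \<otimes> y"
  shows "x [^] (k::int) \<otimes> z = z \<otimes> y [^] k"
proof (cases k rule: int_cases2)
  case (nonneg n)
  then show ?thesis using nat_pow_intertwine[OF assms] by (simp add: int_pow_int)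
next
  case (nonpos n)
  have "inv (x [^] n) \<otimes> z = z \<otimes> inv (y [^] n)"
    using assms by (intro inv_intertwine nat_pow_intertwine) auto
  then show ?thesis using assms nonpos by (simp add: int_pow_neg int_pow_int)
qed

text \<open>\<open>ord\<close> is 0 on elements of infinite order, so positivity expresses finite
  order.\<close>

lemma (in group) ord_pos_if_int_pow_eq_one:
  assumes "x \<in> carrier G" "x [^] (k::int) = \<one>" "k \<noteq> 0"
  shows "ord x > 0"
  using assms by (auto simp: int_pow_eq_id intro: gr0I)

lemma (in group) int_pow_diff_eq_one:
  assumes "x \<in> carrier G" "x [^] (j::int) = x [^] (k::int)"
  shows "x [^] (j - k) = \<one>"
  using assms by (simp add: int_pow_diff)

text \<open>C is a parameter, which the last assumption forces to be [A,B]. Thus exchanging A and B,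
  or passing to a homomorphic image, gives another instance of the locale.\<close>

locale macdonald = group G for G (structure) +
  fixes A B C :: 'a and \<alpha> \<beta> :: int
  assumes A_closed [simp]: "A \<in> carrier G" and B_closed [simp]: "B \<in> carrier G"
    and C_closed [simp]: "C \<in> carrier G"
    and A_C: "A \<otimes> C = C \<otimes> A [^] \<alpha>"
    and C_B: "C \<otimes> B = B [^] \<beta> \<otimes> C"
    and A_B: "A \<otimes> B = B \<otimes> (A \<otimes> C)"
begin

lemma swap: "macdonald G B A (inv C) \<beta> \<alpha>"
proof unfold_locales
  show "B \<otimes> inv C = inv C \<otimes> B [^] \<beta>"
    using intertwine_inv[of "B [^] \<beta>" B C] C_B by simp
  show "inv C \<otimes> A = A [^] \<alpha> \<otimes> inv C"
    using intertwine_inv[of A "A [^] \<alpha>" C] A_C by simp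
  have "A \<otimes> (B \<otimes> inv C) = B \<otimes> A \<otimes> (C \<otimes> inv C)"
    using A_B by (metis A_closed B_closed C_closed inv_closed m_assoc m_closed)
  then show "B \<otimes> A = A \<otimes> (B \<otimes> inv C)" by simp
qed auto

section \<open>Collection formulas and the key relation\<close>

lemma A_pow_C: "A [^] (k::int) \<otimes> C = C \<otimes> A [^] (\<alpha> * k)"
  using int_pow_intertwine[OF _ _ _ A_C, of k] by (simp add: int_pow_pow)

lemma A_pow_C_pow: "A [^] (k::int) \<otimes> C [^] (n::nat) = C [^] n \<otimes> A [^] (\<alpha> ^ n * k)"
proof (induction n)
  case (Suc n)
  have "A [^] k \<otimes> C [^] Suc n = (A [^] k \<otimes> C [^] n) \<otimes> C" by (simp add: m_assoc)
  also have "\<dots> = C [^] n \<otimes> (A [^] (\<alpha> ^ n * k) \<otimes> C)" by (simp add: Suc m_assoc)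
  also have "\<dots> = C [^] Suc n \<otimes> A [^] (\<alpha> ^ Suc n * k)"
    by (simp add: A_pow_C m_assoc mult.assoc)
  finally show ?case .
qed simp

lemma C_pow_B_pow: "C [^] (n::nat) \<otimes> B [^] (k::int) = B [^] (\<beta> ^ n * k) \<otimes> C [^] n"
proof -
  interpret s: macdonald G B A "inv C" \<beta> \<alpha> by (rule swap)
  have "B [^] k \<otimes> inv (C [^] n) = inv (C [^] n) \<otimes> B [^] (\<beta> ^ n * k)"
    using s.A_pow_C_pow[of k n] by (simp add: nat_pow_inv)
  then show ?thesis
    using intertwine_inv[of "B [^] k" "B [^] (\<beta> ^ n * k)" "inv (C [^] n)"] by simp
qed

lemma A_C_pow: "(A \<otimes> C) [^] (n::nat) = C [^] n \<otimes> A [^] power_sum \<alpha> n"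
proof (induction n)
  case (Suc n)
  have "(A \<otimes> C) [^] Suc n = C [^] n \<otimes> (A [^] power_sum \<alpha> n \<otimes> A [^] (1::int) \<otimes> C)"
    by (simp add: Suc m_assoc)
  also have "\<dots> = C [^] n \<otimes> (A [^] (power_sum \<alpha> n + 1) \<otimes> C)"
    by (simp only: int_pow_mult A_closed)
  also have "\<dots> = C [^] Suc n \<otimes> A [^] power_sum \<alpha> (Suc n)"
    by (simp add: A_pow_C m_assoc power_sum_Suc)
  finally show ?case .
qed simp

text \<open>Conjugation by B takes A to \<open>A \<otimes> C\<close>, and \<open>A_C_pow\<close>
  collects the powers of the latter.\<close>

lemma A_pow_B: "A [^] (n::nat) \<otimes> B = B \<otimes> (C [^] n \<otimes> A [^] power_sum \<alpha> n)"
  using nat_pow_intertwine[OF _ _ _ A_B, of n] by (simp add: A_C_pow)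

lemma B_pow_A: "B [^] (n::nat) \<otimes> A = A \<otimes> (inv (C [^] n) \<otimes> B [^] power_sum \<beta> n)"
  using macdonald.A_pow_B[OF swap, of n] by (simp add: nat_pow_inv)

text \<open>Expand the conjugate of \<open>A [^] \<alpha>\<^sup>2\<close> by B in two ways, using
  \<open>A \<otimes> C\<^sup>2 = C\<^sup>2 \<otimes> A [^] \<alpha>\<^sup>2\<close>.\<close>

lemma key_relation:
  assumes a: "int a = \<alpha>\<^sup>2" and b: "int b = \<beta>\<^sup>2"
  shows "B [^] (\<beta> ^ (b + 2) - power_sum \<beta> b) \<otimes> C [^] (b + 2)
    = C [^] (a + 2) \<otimes> A [^] (power_sum \<alpha> a - \<alpha> ^ (a + 2))"
proof -
  let ?S = "power_sum \<alpha> a" and ?T = "power_sum \<beta> b" and ?D = "C [^] (2::nat)"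
  have AD: "A \<otimes> ?D = ?D \<otimes> A [^] a"
    using A_pow_C_pow[of 1 2] a by (metis A_closed int_pow_1 int_pow_int mult.right_neutral)
  have DB: "?D \<otimes> B = B [^] b \<otimes> ?D"
    using C_pow_B_pow[of 2 1] b by (metis B_closed int_pow_1 int_pow_int mult.right_neutral)
  \<comment> \<open>Both ways start from \<open>A \<otimes> ?D \<otimes> B\<close>: either move
    \<open>?D\<close> left past A and then \<open>A [^] a\<close> past B, or move B left past
    \<open>?D\<close> at once.\<close>
  have "B [^] b \<otimes> (C [^] (a + 2) \<otimes> A [^] ?S) = B [^] b \<otimes> (?D \<otimes> C [^] a \<otimes> A [^] ?S)"
    by (simp only: nat_pow_mult C_closed add.commute)
  also have "\<dots> = B [^] b \<otimes> ?D \<otimes> (C [^] a \<otimes> A [^] ?S)"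
    by (simp add: m_assoc)
  also have "\<dots> = ?D \<otimes> (B \<otimes> (C [^] a \<otimes> A [^] ?S))"
    by (simp add: DB[symmetric] m_assoc)
  also have "\<dots> = ?D \<otimes> A [^] a \<otimes> B"
    by (simp add: A_pow_B[symmetric] m_assoc)
  also have "\<dots> = A \<otimes> (?D \<otimes> B)" by (simp add: AD[symmetric] m_assoc)
  finally have 1: "B [^] b \<otimes> (C [^] (a + 2) \<otimes> A [^] ?S) = A \<otimes> (B [^] b \<otimes> ?D)"
    by (simp add: DB)
  \<comment> \<open>This is \<open>B_pow_A\<close> solved for A. Substituting it for A gives both
    sides of the previous equation the left factor \<open>B [^] b\<close>, which then
    cancels.\<close>
  have "B [^] b \<otimes> (A \<otimes> (B [^] (- ?T) \<otimes> C [^] b))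
    = (B [^] b \<otimes> A) \<otimes> (B [^] (- ?T) \<otimes> C [^] b)" by (simp add: m_assoc)
  also have "\<dots> = A \<otimes> (inv (C [^] b) \<otimes> ((B [^] ?T \<otimes> B [^] (- ?T)) \<otimes> C [^] b))"
    by (simp add: B_pow_A m_assoc)
  also have "\<dots> = A" by (simp add: int_pow_mult[symmetric])
  finally have 2: "B [^] b \<otimes> (A \<otimes> (B [^] (- ?T) \<otimes> C [^] b)) = A" .
  have "B [^] b \<otimes> (C [^] (a + 2) \<otimes> A [^] ?S)
    = B [^] b \<otimes> (A \<otimes> (B [^] (- ?T) \<otimes> C [^] b)) \<otimes> (B [^] b \<otimes> ?D)"
    by (simp only: 1 2)
  then have 3: "C [^] (a + 2) \<otimes> A [^] ?S = A \<otimes> (B [^] (- ?T) \<otimes> C [^] b) \<otimes> (B [^] b \<otimes> ?D)"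
    by (simp add: m_assoc)
  have CB: "C [^] b \<otimes> B [^] b = B [^] (\<beta> ^ (b + 2)) \<otimes> C [^] b"
    using C_pow_B_pow[of b "int b"] b by (metis int_pow_int power_add)
  have "A \<otimes> (B [^] (- ?T) \<otimes> C [^] b) \<otimes> (B [^] b \<otimes> ?D)
    = A \<otimes> (B [^] (- ?T) \<otimes> ((C [^] b \<otimes> B [^] b) \<otimes> ?D))" by (simp add: m_assoc)
  also have "\<dots> = A \<otimes> ((B [^] (- ?T) \<otimes> B [^] (\<beta> ^ (b + 2))) \<otimes> (C [^] b \<otimes> ?D))"
    by (simp add: CB m_assoc)
  also have "\<dots> = A \<otimes> (B [^] (\<beta> ^ (b + 2) - ?T) \<otimes> C [^] (b + 2))"
    by (simp only: int_pow_mult[symmetric] nat_pow_mult B_closed C_closed uminus_add_conv_diff)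
  also note 3[symmetric]
  \<comment> \<open>Split off the power of A that turns into a single A in front of
    \<open>C [^] (a + 2)\<close>; this A cancels against the one on the other side.\<close>
  also have "C [^] (a + 2) \<otimes> A [^] ?S
    = C [^] (a + 2) \<otimes> A [^] (\<alpha> ^ (a + 2) * 1) \<otimes> A [^] (?S - \<alpha> ^ (a + 2))"
    by (simp add: m_assoc int_pow_mult[symmetric])
  also have "\<dots> = A [^] (1::int) \<otimes> C [^] (a + 2) \<otimes> A [^] (?S - \<alpha> ^ (a + 2))"
    by (simp only: A_pow_C_pow)
  also have "\<dots> = A \<otimes> (C [^] (a + 2) \<otimes> A [^] (?S - \<alpha> ^ (a + 2)))"
    by (simp add: m_assoc)
  finally show ?thesis by (simp del: power_add)
qed

end

section \<open>Finite order of A and B\<close>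

context macdonald
begin

lemma ord_A_pos_if_alpha_zero:
  assumes "\<alpha> = 0" shows "ord A > 0"
proof -
  have "A \<otimes> C = \<one> \<otimes> C" using A_C assms by simp
  then have "A = \<one>" by (simp only: r_cancel A_closed C_closed one_closed)
  then show ?thesis by simp
qed

text \<open>A power of A commutes with A, while conjugation by \<open>C [^] k\<close> raises A to
  the power \<alpha>^k. The bound on \<alpha> keeps \<alpha>^k - 1 nonzero.\<close>

lemma ord_A_pos_if_C_pow:
  assumes "C [^] (k::nat) = A [^] (j::int)" "k > 0" "\<bar>\<alpha>\<bar> \<ge> 2"
  shows "ord A > 0"
proof -
  have "C [^] k \<otimes> A [^] (\<alpha> ^ k) = A [^] (1::int) \<otimes> C [^] k"
    using A_pow_C_pow[of 1 k] by simp
  also have "\<dots> = C [^] k \<otimes> A [^] (1::int)"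
    unfolding assms(1) by (simp only: int_pow_mult[symmetric] A_closed add.commute)
  finally have "A [^] (\<alpha> ^ k) = A [^] (1::int)" by simp
  then have "A [^] (\<alpha> ^ k - 1) = \<one>" by (intro int_pow_diff_eq_one) auto
  moreover have "\<bar>\<alpha>\<bar> ^ k > 1" using assms by (intro one_less_power) auto
  then have "\<alpha> ^ k - 1 \<noteq> 0" by (auto simp: power_abs[symmetric])
  ultimately show ?thesis by (intro ord_pos_if_int_pow_eq_one) auto
qed

text \<open>The exponent of A in the key relation is \<open>\<alpha>\<close> modulo \<open>\<alpha>\<^sup>2\<close>, hence nonzero.
  The key relation makes this power of A a power of B, hence central.\<close>

lemma ord_A_pos_if_squares_eq:
  assumes eq: "\<alpha>\<^sup>2 = \<beta>\<^sup>2" and \<alpha>: "\<bar>\<alpha>\<bar> \<ge> 2"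
  shows "ord A > 0"
proof -
  define a where "a = nat (\<alpha>\<^sup>2)"
  define u where "u = \<beta> ^ (a + 2) - power_sum \<beta> a"
  define v where "v = power_sum \<alpha> a - \<alpha> ^ (a + 2)"
  let ?D = "C [^] (a + 2)"
  have a: "int a = \<alpha>\<^sup>2" "int a = \<beta>\<^sup>2" using eq by (simp_all add: a_def)
  have key: "B [^] u \<otimes> ?D = ?D \<otimes> A [^] v"
    using key_relation[OF a] by (simp only: u_def v_def)
  \<comment> \<open>Equal squares put the same power \<open>?D\<close> of C on both sides of the key
    relation. Raising that relation to the power \<open>\<alpha> ^ (a + 2)\<close> lets
    \<open>?D\<close> move back across the power of A, leaving exponent v, and cancel.\<close>
  have "B [^] (u * \<alpha> ^ (a + 2)) \<otimes> ?D = ?D \<otimes> A [^] (\<alpha> ^ (a + 2) * v)"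
    using int_pow_intertwine[OF _ _ _ key, of "\<alpha> ^ (a + 2)"]
    by (simp only: int_pow_pow A_closed B_closed C_closed int_pow_closed nat_pow_closed mult.commute)
  also have "\<dots> = A [^] v \<otimes> ?D" by (simp only: A_pow_C_pow)
  finally have vB: "B [^] (u * \<alpha> ^ (a + 2)) = A [^] v"
    by (simp only: r_cancel A_closed B_closed C_closed int_pow_closed nat_pow_closed)
  have comm_A: "A [^] v \<otimes> A = A \<otimes> A [^] v"
    using int_pow_intertwine[of A A A v] by simp
  have comm_B: "A [^] v \<otimes> B = B \<otimes> A [^] v"
    unfolding vB[symmetric] using int_pow_intertwine[of B B B] by simp
  \<comment> \<open>What commutes with A and B commutes with their commutator C. Conjugation by C
    also multiplies the exponent v by \<alpha>.\<close>
  have "B \<otimes> (A \<otimes> (A [^] v \<otimes> C)) = B \<otimes> ((A \<otimes> A [^] v) \<otimes> C)" by (simp add: m_assoc)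
  also have "\<dots> = (B \<otimes> A [^] v) \<otimes> (A \<otimes> C)" by (simp add: comm_A[symmetric] m_assoc)
  also have "\<dots> = A [^] v \<otimes> (A \<otimes> B)" by (simp add: comm_B[symmetric] A_B m_assoc)
  also have "\<dots> = (A \<otimes> A [^] v) \<otimes> B" by (simp add: comm_A[symmetric] m_assoc)
  also have "\<dots> = A \<otimes> B \<otimes> A [^] v" by (simp add: comm_B m_assoc)
  also have "\<dots> = B \<otimes> (A \<otimes> (C \<otimes> A [^] v))" by (simp add: A_B m_assoc)
  finally have "A [^] v \<otimes> C = C \<otimes> A [^] v" by simp
  then have "A [^] (\<alpha> * v) = A [^] v" by (simp add: A_pow_C)
  then have "A [^] (\<alpha> * v - v) = \<one>" by (intro int_pow_diff_eq_one) auto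
  moreover have "v \<noteq> 0"
  proof
    assume "v = 0"
    have "2\<^sup>2 \<le> \<alpha>\<^sup>2" using \<alpha> abs_le_square_iff[of 2 \<alpha>] by simp
    then have "a \<ge> 2" using a(1) by simp
    then obtain k where k: "a = Suc (Suc k)" by (metis add_2_eq_Suc le_Suc_ex)
    have "v = \<alpha> + \<alpha>\<^sup>2 * (power_sum \<alpha> k + 1 - \<alpha> ^ a)"
      unfolding v_def by (simp add: k power_sum_Suc algebra_simps power2_eq_square)
    with \<open>v = 0\<close> have "\<alpha> * (1 + \<alpha> * (power_sum \<alpha> k + 1 - \<alpha> ^ a)) = 0"
      by (simp add: algebra_simps power2_eq_square)
    then have "\<alpha> * (power_sum \<alpha> k + 1 - \<alpha> ^ a) = -1" using \<alpha> by auto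
    then have "\<alpha> dvd 1" by (metis dvd_minus_iff dvd_triv_left)
    then show False using \<alpha> by auto
  qed
  then have "\<alpha> * v - v \<noteq> 0" using \<alpha> by (auto simp: mult_cancel_right1)
  ultimately show ?thesis by (intro ord_pos_if_int_pow_eq_one) auto
qed

text \<open>Since -1 + 1 = 0, the square of A is conjugated by B to the square of C, which commutes
  with B; so the two squares agree. Then C commutes with the square of A and also inverts
  it.\<close>

lemma ord_A_pos_if_minus_one:
  assumes "\<alpha> = -1" "\<beta> = -1"
  shows "ord A > 0"
proof -
  let ?D = "C [^] (2::nat)"
  have "power_sum (- 1) 2 = 0" by (simp add: numeral_2_eq_2 power_sum_Suc)
  then have AB: "A [^] (2::nat) \<otimes> B = B \<otimes> ?D"
    using A_pow_B[of 2] assms by simp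
  have "?D \<otimes> B = B \<otimes> ?D" using C_pow_B_pow[of 2 1] assms by simp
  with AB have "A [^] (2::nat) = ?D" by (metis A_closed B_closed C_closed nat_pow_closed r_cancel)
  then have "A [^] (2::int) = ?D" by (metis int_pow_int of_nat_numeral)
  then have "A [^] (2::int) \<otimes> C = C \<otimes> A [^] (2::int)"
    using nat_pow_intertwine[of C C C 2] by simp
  then have "A [^] (-2::int) = A [^] (2::int)" using assms by (simp add: A_pow_C)
  then have "A [^] (-2 - 2::int) = \<one>" by (intro int_pow_diff_eq_one) auto
  then show ?thesis by (intro ord_pos_if_int_pow_eq_one) auto
qed

text \<open>Here the key relation says that \<open>W = C\<^sup>r A\<^sup>v\<close> with \<open>r > 0\<close> is conjugate to a power of B
  under a power of C, so \<open>C W C\<inverse> = W [^] \<beta>\<close>; comparing exponents of C puts a power of C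
  into the subgroup generated by A.\<close>

lemma ord_A_pos_if_square_greater:
  assumes gr: "\<beta>\<^sup>2 < \<alpha>\<^sup>2" and \<beta>: "\<beta> \<noteq> 0" "\<beta> \<noteq> 1"
  shows "ord A > 0"
proof -
  define a where "a = nat (\<alpha>\<^sup>2)"
  define b where "b = nat (\<beta>\<^sup>2)"
  define u where "u = \<beta> ^ (b + 2) - power_sum \<beta> b"
  define v where "v = power_sum \<alpha> a - \<alpha> ^ (a + 2)"
  define r where "r = a - b"
  define d where "d = b + 2"
  let ?D = "C [^] d" and ?W = "C [^] r \<otimes> A [^] v"
  have ab: "int a = \<alpha>\<^sup>2" "int b = \<beta>\<^sup>2" by (simp_all add: a_def b_def)
  then have r: "r > 0" "b + 2 + r = a + 2" using gr by (auto simp: r_def)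
  have \<alpha>: "\<bar>\<alpha>\<bar> \<ge> 2"
  proof -
    have "\<bar>\<beta>\<bar> < \<bar>\<alpha>\<bar>" using gr abs_le_square_iff[of \<alpha> \<beta>] by linarith
    with \<beta> show ?thesis by linarith
  qed
  \<comment> \<open>The key relation with \<open>C [^] (a + 2)\<close> split as
    \<open>?D \<otimes> C [^] r\<close>.\<close>
  have WD: "B [^] u \<otimes> ?D = ?D \<otimes> ?W"
    using key_relation[OF ab]
    by (simp only: u_def v_def d_def m_assoc[symmetric] nat_pow_mult r(2) A_closed C_closed int_pow_closed nat_pow_closed)
  have CD: "C \<otimes> ?D = ?D \<otimes> C" by (rule nat_pow_intertwine[OF C_closed C_closed C_closed HOL.refl, symmetric])
  \<comment> \<open>C commutes with \<open>?D\<close> and acts on \<open>B [^] u\<close> by raising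
    it to the power \<beta>; conjugation by \<open>?D\<close> carries this over to
    \<open>?W\<close>.\<close>
  have "?D \<otimes> (C \<otimes> ?W) = C \<otimes> (?D \<otimes> ?W)" by (simp add: CD m_assoc[symmetric])
  also have "\<dots> = C [^] (1::nat) \<otimes> B [^] u \<otimes> ?D" by (simp add: WD[symmetric] m_assoc)
  also have "\<dots> = (B [^] u) [^] \<beta> \<otimes> ?D \<otimes> C"
    unfolding C_pow_B_pow by (simp add: int_pow_pow m_assoc CD mult.commute)
  also have "\<dots> = ?D \<otimes> ?W [^] \<beta> \<otimes> C"
    using int_pow_intertwine[OF _ _ _ WD, of \<beta>] by simp
  finally have CW: "C \<otimes> ?W = ?W [^] \<beta> \<otimes> C" by (simp add: m_assoc)
  have W_pow: "\<exists>s::int. ?W [^] n = C [^] (r * n) \<otimes> A [^] s" for n :: nat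
  proof (induction n)
    case 0
    show ?case by (rule exI[of _ 0]) simp
  next
    case (Suc n)
    then obtain s :: int where s: "?W [^] n = C [^] (r * n) \<otimes> A [^] s" by blast
    have "?W [^] Suc n = C [^] (r * n) \<otimes> (A [^] s \<otimes> C [^] r) \<otimes> A [^] v"
      by (simp add: s m_assoc)
    also have "\<dots> = (C [^] (r * n) \<otimes> C [^] r) \<otimes> (A [^] (\<alpha> ^ r * s) \<otimes> A [^] v)"
      by (simp add: A_pow_C_pow m_assoc)
    also have "\<dots> = C [^] (r * Suc n) \<otimes> A [^] (\<alpha> ^ r * s + v)"
      by (simp only: int_pow_mult nat_pow_mult A_closed C_closed mult_Suc_right add.commute[of r])
    finally show ?case by blast
  qed
  \<comment> \<open>In \<open>CW\<close> the exponents of C are 1 + r on the left and \<beta> r + 1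
    on the right. They differ because \<beta> is not 1; the sign of \<beta> decides on which side a
    positive power of C remains.\<close>
  have "\<exists>k>0. \<exists>j::int. C [^] (k::nat) = A [^] j"
  proof (cases "\<beta> > 0")
    case True
    then obtain n where n: "\<beta> = int (Suc n)" "n > 0"
      using \<beta> by (metis gr0I int_nat_eq less_imp_le nat_eq_iff2 of_nat_1 One_nat_def not0_implies_Suc of_nat_0)
    obtain s :: int where s: "?W [^] Suc n = C [^] (r * Suc n) \<otimes> A [^] s" using W_pow by blast
    have "C [^] Suc r \<otimes> A [^] v = C \<otimes> ?W"
      using nat_pow_intertwine[of C C C r] by (simp add: m_assoc[symmetric])
    also have "\<dots> = ?W [^] Suc n \<otimes> C" unfolding CW n(1) int_pow_int ..
    also have "\<dots> = C [^] (r * Suc n) \<otimes> (A [^] s \<otimes> C)" by (simp only: s m_assoc A_closed C_closed int_pow_closed nat_pow_closed)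
    also have "\<dots> = (C [^] (r * Suc n) \<otimes> C [^] (1::nat)) \<otimes> A [^] (\<alpha> * s)" by (simp add: A_pow_C m_assoc)
    also have "C [^] (r * Suc n) \<otimes> C [^] (1::nat) = C [^] Suc r \<otimes> C [^] (r * n)"
      unfolding nat_pow_mult[OF C_closed] by (simp add: add.commute)
    finally have "A [^] v = C [^] (r * n) \<otimes> A [^] (\<alpha> * s)"
      by (simp only: m_assoc l_cancel A_closed C_closed int_pow_closed nat_pow_closed m_closed)
    then have "C [^] (r * n) = A [^] (v - \<alpha> * s)"
      by (simp add: int_pow_diff inv_solve_right)
    then show ?thesis using r n by (intro exI[of _ "r * n"]) auto
  next
    case False
    then obtain n where n: "\<beta> = - int n" by (metis int_cases2 of_nat_0_less_iff gr0I of_nat_0 minus_zero)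
    obtain s :: int where s: "?W [^] n = C [^] (r * n) \<otimes> A [^] s" using W_pow by blast
    have "C [^] (1::nat) \<otimes> \<one> = ?W [^] n \<otimes> (inv (?W [^] n) \<otimes> C)" by (simp add: m_assoc[symmetric])
    also have "\<dots> = ?W [^] n \<otimes> (C \<otimes> ?W)"
      unfolding CW n by (simp add: int_pow_neg int_pow_int)
    also have "\<dots> = C [^] (r * n) \<otimes> (A [^] s \<otimes> (C [^] (1::nat) \<otimes> C [^] r)) \<otimes> A [^] v"
      by (simp add: s m_assoc)
    also have "\<dots> = C [^] (r * n) \<otimes> (A [^] s \<otimes> C [^] (1 + r)) \<otimes> A [^] v"
      by (simp only: nat_pow_mult C_closed)
    also have "\<dots> = (C [^] (r * n) \<otimes> C [^] (1 + r)) \<otimes> (A [^] (\<alpha> ^ (1 + r) * s) \<otimes> A [^] v)"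
      unfolding A_pow_C_pow by (simp add: m_assoc del: nat_pow_Suc)
    also have "C [^] (r * n) \<otimes> C [^] (1 + r) = C [^] (1::nat) \<otimes> C [^] (r * Suc n)"
      unfolding nat_pow_mult[OF C_closed] by (simp add: add.commute)
    finally have "\<one> = C [^] (r * Suc n) \<otimes> A [^] (\<alpha> ^ (1 + r) * s + v)"
      by (simp only: int_pow_mult m_assoc l_cancel A_closed C_closed int_pow_closed nat_pow_closed m_closed one_closed)
    then have "C [^] (r * Suc n) = A [^] (- (\<alpha> ^ (1 + r) * s + v))"
      by (metis A_closed C_closed int_pow_closed int_pow_neg inv_equality inv_inv nat_pow_closed)
    then show ?thesis using r by (intro exI[of _ "r * Suc n"]) auto
  qed
  then show ?thesis using ord_A_pos_if_C_pow \<alpha> by blast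
qed

text \<open>Finite order of A puts a power of C into the subgroup generated by A, so C has finite
  order too. A trivial power \<open>C [^] N\<close> then gives
  \<open>B [^] (\<beta> ^ N - 1) = \<one>\<close>, which is informative unless \<beta> = -1; in that
  case \<open>power_sum \<beta> N\<close> is 0 and \<open>B_pow_A\<close> yields
  \<open>B [^] N = \<one>\<close>.\<close>

lemma ord_B_pos:
  assumes "ord A > 0" "\<beta> \<noteq> 1"
  shows "ord B > 0"
proof (cases "\<beta> = 0")
  case True
  then show ?thesis by (rule macdonald.ord_A_pos_if_alpha_zero[OF swap])
next
  case False
  \<comment> \<open>The factor 2 makes N even, as the case \<beta> = -1 requires.\<close>
  define n where "n = 2 * ord A"
  define N where "N = n * ord A"
  have N: "N > 0" "even N" using assms by (simp_all add: n_def N_def)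
  have "B \<otimes> \<one> = B \<otimes> (C [^] n \<otimes> A [^] power_sum \<alpha> n)"
    using A_pow_B[of n] pow_eq_id[of A n] by (simp add: n_def del: r_cancel_one r_cancel_one' l_cancel)
  then have "\<one> = C [^] n \<otimes> A [^] power_sum \<alpha> n"
    by (simp only: l_cancel A_closed B_closed C_closed int_pow_closed nat_pow_closed m_closed one_closed)
  then have "C [^] n = A [^] (- power_sum \<alpha> n)"
    by (metis A_closed C_closed int_pow_closed int_pow_neg inv_equality inv_inv nat_pow_closed)
  then have "(C [^] n) [^] ord A = A [^] (- power_sum \<alpha> n * int (ord A))"
    by (metis A_closed int_pow_int int_pow_pow)
  also have "\<dots> = \<one>" by (simp add: int_pow_eq_id)
  finally have C: "C [^] N = \<one>" by (simp add: N_def nat_pow_pow)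
  have "B [^] (\<beta> ^ N) = B [^] (1::int)" using C_pow_B_pow[of N 1] C by simp
  then have 1: "B [^] (\<beta> ^ N - 1) = \<one>" by (intro int_pow_diff_eq_one) auto
  show ?thesis
  proof (cases "\<beta> ^ N = 1")
    case False
    with 1 show ?thesis by (intro ord_pos_if_int_pow_eq_one) auto
  next
    case True
    then have "\<bar>\<beta>\<bar> ^ N = 1" by (simp add: power_abs[symmetric])
    then have "\<bar>\<beta>\<bar> = 1" using N one_less_power[of "\<bar>\<beta>\<bar>" N] \<open>\<beta> \<noteq> 0\<close> by linarith
    then have \<beta>: "\<beta> = -1" using assms by linarith
    have "power_sum (-1) (2 * k) = 0" for k
      by (induction k) (simp_all add: power_sum_Suc)
    then have "power_sum \<beta> N = 0" using N \<beta> by auto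
    then have "B [^] N \<otimes> A = \<one> \<otimes> A" using B_pow_A[of N] C by simp
    then have "B [^] N = \<one>" by (simp only: r_cancel A_closed B_closed nat_pow_closed one_closed)
    then show ?thesis using N by (intro ord_pos_if_int_pow_eq_one[of _ "int N"]) (auto simp: int_pow_int)
  qed
qed

text \<open>One finite order suffices, by \<open>ord_B_pos\<close> and its mirror image. It is found
  at the generator whose exponent has the larger square; equal squares leave either absolute value
  at least 2 or both exponents equal to -1.\<close>

lemma ords_pos:
  assumes "\<alpha> \<noteq> 1" "\<beta> \<noteq> 1"
  shows "ord A > 0 \<and> ord B > 0"
proof -
  interpret s: macdonald G B A "inv C" \<beta> \<alpha> by (rule swap)
  have "ord A > 0 \<or> ord B > 0"
  proof (cases "\<alpha> = 0 \<or> \<beta> = 0")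
    case True
    then show ?thesis by (elim disjE) (simp_all add: ord_A_pos_if_alpha_zero s.ord_A_pos_if_alpha_zero)
  next
    case ne: False
    consider "\<beta>\<^sup>2 < \<alpha>\<^sup>2" | "\<alpha>\<^sup>2 < \<beta>\<^sup>2" | "\<alpha>\<^sup>2 = \<beta>\<^sup>2" by linarith
    then show ?thesis
    proof cases
      case 3
      then have "\<bar>\<alpha>\<bar> = \<bar>\<beta>\<bar>" by (simp add: power2_eq_iff abs_eq_iff)
      then have "\<bar>\<alpha>\<bar> \<ge> 2 \<or> (\<alpha> = -1 \<and> \<beta> = -1)" using ne assms by linarith
      then show ?thesis using ord_A_pos_if_squares_eq[OF 3] ord_A_pos_if_minus_one by argo
    next
      case 1
      then show ?thesis using ne assms by (simp add: ord_A_pos_if_square_greater)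
    next
      case 2
      then show ?thesis using ne assms by (simp add: s.ord_A_pos_if_square_greater)
    qed
  qed
  then show ?thesis using ord_B_pos[OF _ assms(2)] s.ord_B_pos[OF _ assms(1)] by argo
qed

section \<open>Powers commuting with the generators\<close>

lemma C_pow_commutes_A:
  assumes "A [^] (n::nat) = \<one>"
  shows "C [^] n \<otimes> A = A \<otimes> C [^] n"
proof -
  \<comment> \<open>With \<open>A [^] n\<close> trivial, \<open>A_pow_B\<close> exhibits
    \<open>C [^] n\<close> as a power of A.\<close>
  have "B \<otimes> \<one> = B \<otimes> (C [^] n \<otimes> A [^] power_sum \<alpha> n)"
    using A_pow_B[of n] assms by simp
  then have "\<one> = C [^] n \<otimes> A [^] power_sum \<alpha> n"
    by (simp only: l_cancel A_closed B_closed C_closed int_pow_closed nat_pow_closed m_closed one_closed)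
  then have "C [^] n = A [^] (- power_sum \<alpha> n)"
    by (metis A_closed C_closed int_pow_closed int_pow_neg inv_equality inv_inv nat_pow_closed)
  then show ?thesis using int_pow_intertwine[of A A A] by simp
qed

text \<open>\<open>C [^] m\<close> centralises A as soon as \<open>ord A\<close> divides \<alpha>^m
  - 1. Trivial \<open>C [^] n\<close> gives this divisibility for n, and
  \<open>dvd_power_minus_one_cofactor\<close> passes it to m.\<close>

lemma C_pow_cofactor_commutes_A:
  fixes n m p :: nat
  assumes p: "Factorial_Ring.prime p" and max: "\<And>q. Factorial_Ring.prime q \<Longrightarrow> q dvd n \<Longrightarrow> q \<le> p"
    and n: "n = p * m" "n > 0" and An: "A [^] n = \<one>" and Cn: "C [^] n = \<one>"
  shows "C [^] m \<otimes> A = A \<otimes> C [^] m"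
proof -
  have "A [^] (\<alpha> ^ n) = A [^] (1::int)" using A_pow_C_pow[of 1 n] Cn by simp
  then have "A [^] (\<alpha> ^ n - 1) = \<one>" by (intro int_pow_diff_eq_one) auto
  then have "int (ord A) dvd \<alpha> ^ n - 1" by (simp add: int_pow_eq_id)
  moreover have "ord A dvd n" using An by (simp add: pow_eq_id)
  ultimately have "int (ord A) dvd \<alpha> ^ m - 1"
    using dvd_power_minus_one_cofactor[OF p max n] by blast
  then have "A [^] (\<alpha> ^ m - 1) = \<one>" by (simp add: int_pow_eq_id)
  then have "A [^] (\<alpha> ^ m - 1 + 1) = A" by (simp only: int_pow_mult A_closed) simp
  then show ?thesis using A_pow_C_pow[of 1 m] by simp
qed

text \<open>Without C, conjugation by B takes \<open>A [^] m\<close> to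
  \<open>A [^] power_sum \<alpha> m\<close>. By \<open>power_sum_cofactor\<close> this is either
  \<open>A [^] m\<close> again or trivial, and in the latter case \<open>A [^] m\<close> is itself
  trivial.\<close>

lemma A_pow_cofactor_commutes_B:
  fixes n m p :: nat
  assumes p: "Factorial_Ring.prime p" and max: "\<And>q. Factorial_Ring.prime q \<Longrightarrow> q dvd n \<Longrightarrow> q \<le> p"
    and n: "n = p * m" "n > 0" and An: "A [^] n = \<one>" and Cm: "C [^] m = \<one>"
  shows "A [^] m \<otimes> B = B \<otimes> A [^] m"
proof -
  have "A [^] (\<alpha> ^ m) = A [^] (1::int)" using A_pow_C_pow[of 1 m] Cm by simp
  then have "A [^] (\<alpha> ^ m - 1) = \<one>" by (intro int_pow_diff_eq_one) auto
  then have "int (ord A) dvd \<alpha> ^ m - 1" by (simp add: int_pow_eq_id)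
  moreover have "ord A dvd n" using An by (simp add: pow_eq_id)
  ultimately have "int (ord A) dvd power_sum \<alpha> m \<or> int (ord A) dvd power_sum \<alpha> m - int m"
    using power_sum_cofactor[OF p max n] by blast
  then have "A [^] power_sum \<alpha> m = \<one> \<or> A [^] (power_sum \<alpha> m - int m) = \<one>"
    by (simp add: int_pow_eq_id)
  note * = this
  have AB: "A [^] m \<otimes> B = B \<otimes> A [^] power_sum \<alpha> m" using A_pow_B[of m] Cm by simp
  from * show ?thesis
  proof
    assume "A [^] power_sum \<alpha> m = \<one>"
    with AB have "A [^] m \<otimes> B = \<one> \<otimes> B" by simp
    then have "A [^] m = \<one>" by (simp only: r_cancel A_closed B_closed nat_pow_closed one_closed)
    then show ?thesis by simp
  next
    assume "A [^] (power_sum \<alpha> m - int m) = \<one>"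
    then have "A [^] (power_sum \<alpha> m - int m + int m) = A [^] m"
      by (simp only: int_pow_mult A_closed) (simp add: int_pow_int)
    with AB show ?thesis by simp
  qed
qed

lemma C_pow_commutes_B:
  assumes "B [^] (n::nat) = \<one>"
  shows "C [^] n \<otimes> B = B \<otimes> C [^] n"
  using inv_intertwine[OF _ _ _ macdonald.C_pow_commutes_A[OF swap assms]]
  by (simp add: nat_pow_inv)

lemma C_pow_cofactor_commutes_B:
  fixes n m p :: nat
  assumes p: "Factorial_Ring.prime p" and max: "\<And>q. Factorial_Ring.prime q \<Longrightarrow> q dvd n \<Longrightarrow> q \<le> p"
    and n: "n = p * m" "n > 0" and Bn: "B [^] n = \<one>" and Cn: "C [^] n = \<one>"
  shows "C [^] m \<otimes> B = B \<otimes> C [^] m"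
proof -
  have "inv C [^] n = \<one>" using Cn by (simp add: nat_pow_inv)
  then have "inv C [^] m \<otimes> B = B \<otimes> inv C [^] m"
    using macdonald.C_pow_cofactor_commutes_A[OF swap p max n Bn] by blast
  then show ?thesis using inv_intertwine[of "inv C [^] m" "inv C [^] m" B] by (simp add: nat_pow_inv)
qed

lemma B_pow_cofactor_commutes_A:
  fixes n m p :: nat
  assumes p: "Factorial_Ring.prime p" and max: "\<And>q. Factorial_Ring.prime q \<Longrightarrow> q dvd n \<Longrightarrow> q \<le> p"
    and n: "n = p * m" "n > 0" and Bn: "B [^] n = \<one>" and Cm: "C [^] m = \<one>"
  shows "B [^] m \<otimes> A = A \<otimes> B [^] m"
proof -
  have "inv C [^] m = \<one>" using Cm by (simp add: nat_pow_inv)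
  then show ?thesis
    using macdonald.A_pow_cofactor_commutes_B[OF swap p max n Bn] by blast
qed

end

section \<open>Central series\<close>

text \<open>For normal N this is the preimage in G of the centre of \<open>G Mod N\<close>.\<close>

definition central_mod :: "('a, 'b) monoid_scheme \<Rightarrow> 'a set \<Rightarrow> 'a set" where
  "central_mod G N = {z \<in> carrier G. \<forall>x \<in> carrier G.
     N #>\<^bsub>G\<^esub> (x \<otimes>\<^bsub>G\<^esub> z) = N #>\<^bsub>G\<^esub> (z \<otimes>\<^bsub>G\<^esub> x)}"

lemma central_mod_closed: "z \<in> central_mod G N \<Longrightarrow> z \<in> carrier G"
  by (simp add: central_mod_def)

lemma (in normal) group_hom_FactGroup: "group_hom G (G Mod H) (\<lambda>x. H #> x)"
  using r_coset_hom_Mod factorgroup_is_group is_group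
  by (simp add: group_hom_def group_hom_axioms_def)

lemma (in normal) mem_iff_rcoset_eq_one:
  assumes "x \<in> carrier G" shows "x \<in> H \<longleftrightarrow> H #> x = \<one>\<^bsub>G Mod H\<^esub>"
  using assms by (metis one_FactGroup coset_join1 coset_join2 is_subgroup subgroup.subset)

lemma (in group_hom) generate_commutes:
  assumes "x \<in> generate G S" "S \<subseteq> carrier G" "w \<in> carrier H"
    and comm: "\<And>s. s \<in> S \<Longrightarrow> h s \<otimes>\<^bsub>H\<^esub> w = w \<otimes>\<^bsub>H\<^esub> h s"
  shows "h x \<otimes>\<^bsub>H\<^esub> w = w \<otimes>\<^bsub>H\<^esub> h x"
  using assms(1)
proof induction
  case one
  show ?case using assms by simp
next
  case (incl s)
  then show ?case by (rule comm)
next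
  case (inv s)
  have s: "s \<in> carrier G" using inv assms by blast
  then show ?case using H.inv_intertwine[OF _ _ assms(3) comm[OF inv]] by simp
next
  case (eng x y)
  have [simp]: "x \<in> carrier G" "y \<in> carrier G"
    using eng.hyps assms(2) G.generate_in_carrier by blast+
  have "h (x \<otimes> y) \<otimes>\<^bsub>H\<^esub> w = h x \<otimes>\<^bsub>H\<^esub> (h y \<otimes>\<^bsub>H\<^esub> w)"
    using assms by (simp add: H.m_assoc)
  also have "\<dots> = (h x \<otimes>\<^bsub>H\<^esub> w) \<otimes>\<^bsub>H\<^esub> h y"
    using assms(3) by (simp add: eng.IH(2) H.m_assoc)
  also have "\<dots> = w \<otimes>\<^bsub>H\<^esub> h (x \<otimes> y)"
    using assms(3) by (simp add: eng.IH(1) H.m_assoc)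
  finally show ?case .
qed

context normal
begin

lemma central_mod_iff:
  "z \<in> central_mod G H \<longleftrightarrow> z \<in> carrier G \<and> (\<forall>x \<in> carrier G.
     (H #> x) \<otimes>\<^bsub>G Mod H\<^esub> (H #> z) = (H #> z) \<otimes>\<^bsub>G Mod H\<^esub> (H #> x))"
proof -
  interpret h: group_hom G "G Mod H" "\<lambda>x. H #> x" by (rule group_hom_FactGroup)
  show ?thesis by (auto simp: central_mod_def h.hom_mult simp del: mult_FactGroup)
qed

lemma central_mod_commutes:
  assumes "z \<in> central_mod G H" "x \<in> carrier G"
  shows "(H #> x) \<otimes>\<^bsub>G Mod H\<^esub> (H #> z) = (H #> z) \<otimes>\<^bsub>G Mod H\<^esub> (H #> x)"
  using assms by (simp only: central_mod_iff)

lemma subset_central_mod: "H \<subseteq> central_mod G H"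
proof
  interpret h: group_hom G "G Mod H" "\<lambda>x. H #> x" by (rule group_hom_FactGroup)
  fix z assume "z \<in> H"
  then have "z \<in> carrier G" "H #> z = \<one>\<^bsub>G Mod H\<^esub>"
    using mem_iff_rcoset_eq_one subset by blast+
  then show "z \<in> central_mod G H"
    by (simp add: central_mod_iff h.hom_closed del: mult_FactGroup one_FactGroup)
qed

lemma normal_central_mod: "central_mod G H \<lhd> G"
proof -
  interpret h: group_hom G "G Mod H" "\<lambda>x. H #> x" by (rule group_hom_FactGroup)
  note [simp del] = mult_FactGroup one_FactGroup
  have sub: "subgroup (central_mod G H) G"
  proof (rule subgroupI)
    show "central_mod G H \<subseteq> carrier G" by (auto simp: central_mod_def)
    show "central_mod G H \<noteq> {}" using subsetD[OF subset_central_mod subgroup.one_closed[OF is_subgroup]] by (metis empty_iff)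
    fix y z assume y: "y \<in> central_mod G H"
    then have [simp]: "y \<in> carrier G" by (simp add: central_mod_closed)
    show "inv y \<in> central_mod G H"
      unfolding central_mod_iff
    proof (intro conjI ballI)
      fix x assume x: "x \<in> carrier G"
      have "(H #> y) \<otimes>\<^bsub>G Mod H\<^esub> (H #> x) = (H #> x) \<otimes>\<^bsub>G Mod H\<^esub> (H #> y)"
        by (rule central_mod_commutes[OF y x, symmetric])
      then show "(H #> x) \<otimes>\<^bsub>G Mod H\<^esub> (H #> inv y) = (H #> inv y) \<otimes>\<^bsub>G Mod H\<^esub> (H #> x)"
        using h.H.inv_intertwine[of "H #> y" "H #> y" "H #> x"] x by simp
    qed simp
    assume z: "z \<in> central_mod G H"
    then have [simp]: "z \<in> carrier G" by (simp add: central_mod_closed)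
    show "y \<otimes> z \<in> central_mod G H"
      unfolding central_mod_iff
    proof (intro conjI ballI)
      fix x assume x [simp]: "x \<in> carrier G"
      have yx: "(H #> x) \<otimes>\<^bsub>G Mod H\<^esub> (H #> y) = (H #> y) \<otimes>\<^bsub>G Mod H\<^esub> (H #> x)"
        and zx: "(H #> x) \<otimes>\<^bsub>G Mod H\<^esub> (H #> z) = (H #> z) \<otimes>\<^bsub>G Mod H\<^esub> (H #> x)"
        by (rule central_mod_commutes[OF y x], rule central_mod_commutes[OF z x])
      have "(H #> x) \<otimes>\<^bsub>G Mod H\<^esub> (H #> (y \<otimes> z))
        = ((H #> x) \<otimes>\<^bsub>G Mod H\<^esub> (H #> y)) \<otimes>\<^bsub>G Mod H\<^esub> (H #> z)"
        by (simp add: h.H.m_assoc)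
      also have "\<dots> = (H #> y) \<otimes>\<^bsub>G Mod H\<^esub> ((H #> x) \<otimes>\<^bsub>G Mod H\<^esub> (H #> z))"
        by (simp add: yx h.H.m_assoc)
      also have "\<dots> = (H #> (y \<otimes> z)) \<otimes>\<^bsub>G Mod H\<^esub> (H #> x)"
        by (simp add: zx h.H.m_assoc)
      finally show "(H #> x) \<otimes>\<^bsub>G Mod H\<^esub> (H #> (y \<otimes> z))
        = (H #> (y \<otimes> z)) \<otimes>\<^bsub>G Mod H\<^esub> (H #> x)" .
    qed simp
  qed
  show ?thesis
  proof (rule normal_invI[OF sub])
    fix x z assume x [simp]: "x \<in> carrier G" and z: "z \<in> central_mod G H"
    then have [simp]: "z \<in> carrier G" by (simp add: central_mod_closed)
    have "H #> (x \<otimes> z \<otimes> inv x) = ((H #> x) \<otimes>\<^bsub>G Mod H\<^esub> (H #> z)) \<otimes>\<^bsub>G Mod H\<^esub> inv\<^bsub>G Mod H\<^esub> (H #> x)"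
      by simp
    also have "(H #> x) \<otimes>\<^bsub>G Mod H\<^esub> (H #> z) = (H #> z) \<otimes>\<^bsub>G Mod H\<^esub> (H #> x)"
      by (rule central_mod_commutes[OF z x])
    also have "(H #> z) \<otimes>\<^bsub>G Mod H\<^esub> (H #> x) \<otimes>\<^bsub>G Mod H\<^esub> inv\<^bsub>G Mod H\<^esub> (H #> x) = H #> z"
      by (simp add: h.H.m_assoc del: h.hom_inv)
    finally have "H #> (x \<otimes> z \<otimes> inv x) = H #> z" .
    then show "x \<otimes> z \<otimes> inv x \<in> central_mod G H"
      using z unfolding central_mod_iff by (simp only: x m_closed inv_closed) blast
  qed
qed

text \<open>A commutator with an element central modulo H has trivial coset. So reaching H takes at
  most one step more than reaching \<open>central_mod G H\<close>.\<close>

lemma lower_central_Suc_subset: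
  assumes "lower_central G k \<subseteq> central_mod G H"
  shows "lower_central G (Suc k) \<subseteq> H"
  unfolding lower_central.simps
proof (rule generate_subgroup_incl[OF _ is_subgroup], clarify)
  interpret h: group_hom G "G Mod H" "\<lambda>x. H #> x" by (rule group_hom_FactGroup)
  note [simp del] = mult_FactGroup one_FactGroup
  fix x y assume x [simp]: "x \<in> carrier G" and "y \<in> lower_central G k"
  then have y: "y \<in> central_mod G H" using assms by blast
  then have [simp]: "y \<in> carrier G" by (simp add: central_mod_closed)
  have "x \<otimes> y \<otimes> inv x \<otimes> inv y = (x \<otimes> y) \<otimes> inv (y \<otimes> x)"
    by (simp add: inv_mult_group m_assoc)
  moreover have "H #> (x \<otimes> y) = H #> (y \<otimes> x)"
    using y by (simp add: central_mod_def)
  ultimately have "H #> (x \<otimes> y \<otimes> inv x \<otimes> inv y) = \<one>\<^bsub>G Mod H\<^esub>"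
    by (metis \<open>y \<in> carrier G\<close> h.H.r_inv h.hom_closed h.hom_inv h.hom_mult inv_closed m_closed x)
  then show "x \<otimes> y \<otimes> inv x \<otimes> inv y \<in> H"
    by (subst mem_iff_rcoset_eq_one) simp_all
qed

end

text \<open>This makes the commutation lemmas available in quotients, where more powers of A, B and
  C are trivial.\<close>

lemma (in macdonald) macdonald_hom:
  assumes "group_hom G H h"
  shows "macdonald H (h A) (h B) (h C) \<alpha> \<beta>"
proof -
  interpret h: group_hom G H h by (rule assms)
  show ?thesis
  proof unfold_locales
    show "h A \<otimes>\<^bsub>H\<^esub> h C = h C \<otimes>\<^bsub>H\<^esub> h A [^]\<^bsub>H\<^esub> \<alpha>"
      using arg_cong[OF A_C, of h] by (simp add: h.hom_int_pow)
    show "h C \<otimes>\<^bsub>H\<^esub> h B = h B [^]\<^bsub>H\<^esub> \<beta> \<otimes>\<^bsub>H\<^esub> h C"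
      using arg_cong[OF C_B, of h] by (simp add: h.hom_int_pow)
    show "h A \<otimes>\<^bsub>H\<^esub> h B = h B \<otimes>\<^bsub>H\<^esub> (h A \<otimes>\<^bsub>H\<^esub> h C)"
      using arg_cong[OF A_B, of h] by simp
  qed simp_all
qed

section \<open>Descent of the lower central series\<close>

locale generated_macdonald = macdonald +
  assumes carrier_eq: "carrier G = generate G {A, B}"
begin

lemma central_modI:
  assumes N: "N \<lhd> G" and w: "w \<in> carrier G"
    and A: "(N #> w) \<otimes>\<^bsub>G Mod N\<^esub> (N #> A) = (N #> A) \<otimes>\<^bsub>G Mod N\<^esub> (N #> w)"
    and B: "(N #> w) \<otimes>\<^bsub>G Mod N\<^esub> (N #> B) = (N #> B) \<otimes>\<^bsub>G Mod N\<^esub> (N #> w)"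
  shows "w \<in> central_mod G N"
proof -
  interpret N: normal N G by (rule N)
  interpret h: group_hom G "G Mod N" "\<lambda>x. N #> x" by (rule N.group_hom_FactGroup)
  have "(N #> x) \<otimes>\<^bsub>G Mod N\<^esub> (N #> w) = (N #> w) \<otimes>\<^bsub>G Mod N\<^esub> (N #> x)" if "x \<in> carrier G" for x
  proof (rule h.generate_commutes)
    show "x \<in> generate G {A, B}" using that by (simp flip: carrier_eq)
  qed (use w A B in auto)
  then show ?thesis using w by (simp add: N.central_mod_iff)
qed

context
  fixes N assumes N: "N \<lhd> G"
begin

interpretation h: group_hom G "G Mod N" "\<lambda>x. N #> x"
  by (rule normal.group_hom_FactGroup[OF N])

interpretation quotient: macdonald "G Mod N" "N #> A" "N #> B" "N #> C" \<alpha> \<beta>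
  by (rule macdonald_hom[OF normal.group_hom_FactGroup[OF N]])

lemma rcoset_nat_pow_eq_one:
  assumes "x \<in> carrier G" "x [^] (n::nat) \<in> N"
  shows "(N #> x) [^]\<^bsub>G Mod N\<^esub> n = \<one>\<^bsub>G Mod N\<^esub>"
  using assms normal.mem_iff_rcoset_eq_one[OF N, of "x [^] n"] h.hom_nat_pow[of x n] nat_pow_closed
  by metis

lemma nat_pow_central_modI:
  assumes "x \<in> carrier G"
    and "(N #> x) [^]\<^bsub>G Mod N\<^esub> n \<otimes>\<^bsub>G Mod N\<^esub> (N #> A) = (N #> A) \<otimes>\<^bsub>G Mod N\<^esub> (N #> x) [^]\<^bsub>G Mod N\<^esub> n"
    and "(N #> x) [^]\<^bsub>G Mod N\<^esub> n \<otimes>\<^bsub>G Mod N\<^esub> (N #> B) = (N #> B) \<otimes>\<^bsub>G Mod N\<^esub> (N #> x) [^]\<^bsub>G Mod N\<^esub> n"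
  shows "x [^] (n::nat) \<in> central_mod G N"
  using assms by (intro central_modI[OF N]) (simp_all add: h.hom_nat_pow del: mult_FactGroup)

lemma C_pow_central_mod:
  assumes "A [^] n \<in> N" "B [^] n \<in> N"
  shows "C [^] (n::nat) \<in> central_mod G N"
  using assms rcoset_nat_pow_eq_one
  by (intro nat_pow_central_modI quotient.C_pow_commutes_A quotient.C_pow_commutes_B) auto

context
  fixes n m p :: nat
  assumes p: "Factorial_Ring.prime p" and max: "\<And>q. Factorial_Ring.prime q \<Longrightarrow> q dvd n \<Longrightarrow> q \<le> p"
    and n: "n = p * m" "n > 0" and An: "A [^] n \<in> N" and Bn: "B [^] n \<in> N"
begin

lemma C_pow_cofactor_central_mod:
  assumes "C [^] n \<in> N"
  shows "C [^] m \<in> central_mod G N"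
  using rcoset_nat_pow_eq_one assms An Bn
    quotient.C_pow_cofactor_commutes_A[OF p max n] quotient.C_pow_cofactor_commutes_B[OF p max n]
  by (intro nat_pow_central_modI) (simp_all del: mult_FactGroup one_FactGroup)

lemma A_B_pow_cofactor_central_mod:
  assumes "C [^] m \<in> N"
  shows "A [^] m \<in> central_mod G N" "B [^] m \<in> central_mod G N"
  using rcoset_nat_pow_eq_one assms An Bn
    quotient.A_pow_cofactor_commutes_B[OF p max n] quotient.B_pow_cofactor_commutes_A[OF p max n]
    h.H.nat_pow_intertwine[OF _ _ _ HOL.refl]
  by (auto intro!: nat_pow_central_modI simp del: mult_FactGroup one_FactGroup)

end

end

text \<open>The induction on n must range over all normal N: passing from n to its cofactor m
  replaces N by a larger subgroup, three central steps above it.\<close>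

lemma lower_central_subset:
  "\<lbrakk>n > 0; N \<lhd> G; A [^] (n::nat) \<in> N; B [^] n \<in> N\<rbrakk> \<Longrightarrow> \<exists>k. lower_central G k \<subseteq> N"
proof (induction n arbitrary: N rule: less_induct)
  case (less n)
  note N = \<open>N \<lhd> G\<close>
  have step: "\<exists>k. lower_central G k \<subseteq> M"
    if "M \<lhd> G" "\<exists>k. lower_central G k \<subseteq> central_mod G M" for M
    using that normal.lower_central_Suc_subset by blast
  show ?case
  proof (cases "n = 1")
    case True
    then have "{A, B} \<subseteq> N" using less.prems by simp
    then have "lower_central G 0 \<subseteq> N"
      using generate_subgroup_incl[OF _ normal_imp_subgroup[OF N]] by (simp add: carrier_eq)
    then show ?thesis by blast
  next
    case False
    define P where "P = {q. Factorial_Ring.prime q \<and> q dvd n}"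
    define p where "p = Max P"
    have fin: "finite P" unfolding P_def using \<open>n > 0\<close> by (intro finite_subset[OF _ finite_divisors_nat]) auto
    have "P \<noteq> {}" unfolding P_def using False prime_factor_nat[of n] by blast
    with fin have "p \<in> P" unfolding p_def by (rule Max_in)
    then have p: "Factorial_Ring.prime p" "p dvd n" by (simp_all add: P_def)
    have max: "q \<le> p" if "Factorial_Ring.prime q" "q dvd n" for q
      unfolding p_def using fin that by (intro Max_ge) (auto simp: P_def)
    obtain m where m: "n = p * m" using p by blast
    have m0: "m > 0" "m < n" using m \<open>n > 0\<close> prime_gt_1_nat[OF p(1)] by auto
    \<comment> \<open>One layer for each commutation result: \<open>C [^] n\<close> enters N1, then
      \<open>C [^] m\<close> enters N2, then \<open>A [^] m\<close> and \<open>B [^] m\<close> enter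
      N3.\<close>
    define N1 where "N1 = central_mod G N"
    define N2 where "N2 = central_mod G N1"
    define N3 where "N3 = central_mod G N2"
    have N1: "N1 \<lhd> G" "N \<subseteq> N1" unfolding N1_def
      using N normal.normal_central_mod normal.subset_central_mod by blast+
    have N2: "N2 \<lhd> G" "N1 \<subseteq> N2" unfolding N2_def
      using N1 normal.normal_central_mod normal.subset_central_mod by blast+
    have N3: "N3 \<lhd> G" unfolding N3_def using N2 normal.normal_central_mod by blast
    have "C [^] n \<in> N1"
      unfolding N1_def using less.prems by (intro C_pow_central_mod)
    then have "C [^] m \<in> N2"
      unfolding N2_def using less.prems N1
      by (intro C_pow_cofactor_central_mod[OF N1(1) p(1) max m \<open>n > 0\<close>]) auto
    then have "A [^] m \<in> N3" "B [^] m \<in> N3"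
      unfolding N3_def using less.prems N1 N2
        A_B_pow_cofactor_central_mod[OF N2(1) p(1) max m \<open>n > 0\<close>] by blast+
    then have "\<exists>k. lower_central G k \<subseteq> N3" using less.IH[OF m0(2,1) N3] by blast
    then show ?thesis using step[OF N2(1)] step[OF N1(1)] step[OF N]
      unfolding N1_def N2_def N3_def by blast
  qed
qed

theorem nilpotent_if_ne_one:
  assumes "\<alpha> \<noteq> 1" "\<beta> \<noteq> 1"
  shows "nilpotent G"
proof -
  have "A [^] (ord A * ord B) = \<one>" "B [^] (ord A * ord B) = \<one>" by (simp_all add: pow_eq_id)
  moreover have "{\<one>} \<lhd> G" by (rule one_is_normal)
  ultimately obtain k where k: "lower_central G k \<subseteq> {\<one>}"
    using lower_central_subset[of "ord A * ord B" "{\<one>}"] ords_pos[OF assms] by auto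
  \<comment> \<open>Turns the inclusion in the trivial subgroup into the equality demanded by
    \<open>nilpotent\<close>.\<close>
  moreover have "\<one> \<in> lower_central G k"
    by (cases k) (auto intro: generate.one)
  ultimately show ?thesis unfolding nilpotent_def using is_group by blast
qed

end

section \<open>The presented group\<close>

lemma flip_flip [simp]: "flip (flip x) = x"
  by (simp add: flip_def)

lemma pres_eq_append:
  assumes "pres_eq R u v" shows "pres_eq R (a @ u @ b) (a @ v @ b)"
  using assms
proof induction
  case (cancel u x v)
  show ?case using pres_eq.cancel[of R "a @ u" x "v @ b"] by simp
next
  case (relator r u v)
  show ?case using pres_eq.relator[OF relator, of "a @ u" "v @ b"] by simp
qed (blast intro: pres_eq.refl pres_eq.sym pres_eq.trans)+

lemma pres_eq_append2:
  assumes "pres_eq R u u'" "pres_eq R v v'" shows "pres_eq R (u @ v) (u' @ v')"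
  using pres_eq_append[OF assms(1), of "[]" v] pres_eq_append[OF assms(2), of u' "[]"]
    pres_eq.trans[of R "u @ v" "u' @ v"] by simp

lemma pres_cls_eq_iff: "pres_cls R u = pres_cls R v \<longleftrightarrow> pres_eq R u v"
proof
  assume "pres_cls R u = pres_cls R v"
  moreover have "v \<in> pres_cls R v" by (simp add: pres_cls_def pres_eq.refl)
  ultimately show "pres_eq R u v" unfolding pres_cls_def by blast
next
  assume uv: "pres_eq R u v"
  show "pres_cls R u = pres_cls R v"
    unfolding pres_cls_def using pres_eq.trans[OF uv] pres_eq.trans[OF pres_eq.sym[OF uv]] by blast
qed

text \<open>The product chooses representatives by \<open>SOME\<close>; each is equivalent to the
  given word, and equivalence is compatible with concatenation.\<close>

lemma pres_cls_mult:
  "pres_cls R u \<otimes>\<^bsub>presented_group R\<^esub> pres_cls R v = pres_cls R (u @ v)"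
proof -
  have "pres_eq R w (SOME w'. w' \<in> pres_cls R w)" for w
    using someI[of "\<lambda>w'. w' \<in> pres_cls R w" w] by (simp add: pres_cls_def pres_eq.refl)
  then show ?thesis
    by (simp add: presented_group_def pres_cls_eq_iff pres_eq.sym[OF pres_eq_append2])
qed

lemma pres_one: "\<one>\<^bsub>presented_group R\<^esub> = pres_cls R []"
  by (simp add: presented_group_def)

lemma pres_cls_closed [simp]: "pres_cls R w \<in> carrier (presented_group R)"
  by (simp add: presented_group_def)

lemma pres_cls_cases:
  assumes "S \<in> carrier (presented_group R)" obtains w where "S = pres_cls R w"
  using assms by (auto simp: presented_group_def)

lemma pres_eq_winv: "pres_eq R (winv w @ w) []"
proof (induction w)
  case (Cons x w)
  \<comment> \<open>The rule \<open>cancel\<close> at the letter \<open>flip x\<close>, whose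
    flipped partner is x.\<close>
  have "pres_eq R (winv w @ [flip x, flip (flip x)] @ w) (winv w @ w)" by (rule pres_eq.cancel)
  then show ?case using pres_eq.trans[OF _ Cons] by (simp add: winv_def)
qed (simp add: winv_def pres_eq.refl)

lemma group_presented_group: "group (presented_group R)"
proof (rule groupI)
  fix S assume "S \<in> carrier (presented_group R)"
  then obtain w where "S = pres_cls R w" by (rule pres_cls_cases)
  then have "pres_cls R (winv w) \<otimes>\<^bsub>presented_group R\<^esub> S = \<one>\<^bsub>presented_group R\<^esub>"
    by (simp add: pres_cls_mult pres_one pres_cls_eq_iff pres_eq_winv)
  then show "\<exists>T\<in>carrier (presented_group R). T \<otimes>\<^bsub>presented_group R\<^esub> S = \<one>\<^bsub>presented_group R\<^esub>"
    using pres_cls_closed by blast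
qed (auto elim!: pres_cls_cases simp: pres_cls_mult pres_one)

lemma pres_cls_winv: "pres_cls R (winv w) = inv\<^bsub>presented_group R\<^esub> pres_cls R w"
  by (rule group.inv_equality[OF group_presented_group, symmetric])
    (simp_all add: pres_cls_mult pres_one pres_cls_eq_iff pres_eq_winv)

lemma pres_cls_flip: "pres_cls R [flip x] = inv\<^bsub>presented_group R\<^esub> pres_cls R [x]"
  using pres_cls_winv[of R "[x]"] by (simp add: winv_def)

lemma pres_cls_replicate:
  "pres_cls R (replicate n x) = pres_cls R [x] [^]\<^bsub>presented_group R\<^esub> n"
proof (induction n)
  case (Suc n)
  have "pres_cls R (replicate (Suc n) x) = pres_cls R (replicate n x @ [x])"
    by (simp add: replicate_append_same)
  then show ?case using Suc by (simp flip: pres_cls_mult)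
qed (simp add: pres_one)

lemma pres_cls_wpow: "pres_cls R (wpow x k) = pres_cls R [x] [^]\<^bsub>presented_group R\<^esub> k"
  by (simp add: wpow_def pres_cls_replicate pres_cls_flip int_pow_def2
      group.nat_pow_inv[OF group_presented_group] del: pow_nat)

lemma pres_cls_relator: "r \<in> R \<Longrightarrow> pres_cls R r = \<one>\<^bsub>presented_group R\<^esub>"
  using pres_eq.relator[of r R "[]" "[]"] by (simp add: pres_one pres_cls_eq_iff)

lemma presented_group_generate:
  "carrier (presented_group R) = generate (presented_group R) {pres_cls R [lA], pres_cls R [lB]}"
  (is "carrier ?G = generate ?G ?S")
proof
  interpret group ?G by (rule group_presented_group)
  show "generate ?G ?S \<subseteq> carrier ?G" by (intro generate_incl) auto
  have letter: "pres_cls R [x] \<in> generate ?G ?S" for x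
  proof -
    have *: "pres_cls R [(g, False)] \<in> ?S" for g by (cases g) auto
    obtain g b where x: "x = (g, b)" by (cases x)
    show ?thesis
    proof (cases b)
      case True
      then have "pres_cls R [x] = inv\<^bsub>?G\<^esub> pres_cls R [(g, False)]"
        using pres_cls_flip[of R "(g, False)"] x by (simp add: flip_def)
      then show ?thesis using generate.inv[OF *] by simp
    qed (use x generate.incl[OF *] in simp)
  qed
  have "pres_cls R w \<in> generate ?G ?S" for w
  proof (induction w)
    case Nil
    show ?case by (simp add: generate.one flip: pres_one)
  next
    case (Cons x w)
    then show ?case using generate.eng[OF letter[of x] Cons] by (simp add: pres_cls_mult)
  qed
  then show "carrier ?G \<subseteq> generate ?G ?S" by (auto elim: pres_cls_cases)
qed

lemma generated_macdonald_G_ab: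
  fixes \<alpha> \<beta> :: int
  defines "c \<equiv> pres_cls (G_rels \<alpha> \<beta>)"
  shows "generated_macdonald (G_ab \<alpha> \<beta>) (c [lA]) (c [lB]) (c (comm_word lA lB)) \<alpha> \<beta>"
proof -
  let ?G = "G_ab \<alpha> \<beta>"
  let ?A = "c [lA]" and ?B = "c [lB]" and ?C = "c (comm_word lA lB)"
  interpret group ?G unfolding G_ab_def by (rule group_presented_group)
  have closed [simp]: "c w \<in> carrier ?G" for w by (simp add: c_def G_ab_def)
  have app: "c (u @ v) = c u \<otimes>\<^bsub>?G\<^esub> c v" for u v by (simp add: c_def G_ab_def pres_cls_mult)
  have winv: "c (winv w) = inv\<^bsub>?G\<^esub> c w" for w by (simp add: c_def G_ab_def pres_cls_winv)
  have wpow: "c (wpow x k) = c [x] [^]\<^bsub>?G\<^esub> k" for x k by (simp add: c_def G_ab_def pres_cls_wpow)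
  have flip: "c [flip x] = inv\<^bsub>?G\<^esub> c [x]" for x by (simp add: c_def G_ab_def pres_cls_flip)
  have rel: "c r = \<one>\<^bsub>?G\<^esub>" if "r \<in> G_rels \<alpha> \<beta>" for r
    using pres_cls_relator[OF that] by (simp add: c_def G_ab_def)
  have "comm_word lB lA = winv (comm_word lA lB)"
    by (simp add: comm_word_def winv_def)
  then have C': "c (comm_word lB lA) = inv\<^bsub>?G\<^esub> ?C" by (simp add: winv)
  \<comment> \<open>Both relators have this shape, with z the commutator; each is solved into its
    inverse-free form in the same way.\<close>
  have conj: "x \<otimes>\<^bsub>?G\<^esub> z = z \<otimes>\<^bsub>?G\<^esub> x [^]\<^bsub>?G\<^esub> k"
    if "inv\<^bsub>?G\<^esub> z \<otimes>\<^bsub>?G\<^esub> (x \<otimes>\<^bsub>?G\<^esub> (z \<otimes>\<^bsub>?G\<^esub> x [^]\<^bsub>?G\<^esub> (- k))) = \<one>\<^bsub>?G\<^esub>"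
      "x \<in> carrier ?G" "z \<in> carrier ?G" for x z and k :: int
  proof -
    have "x \<otimes>\<^bsub>?G\<^esub> z \<otimes>\<^bsub>?G\<^esub> inv\<^bsub>?G\<^esub> (x [^]\<^bsub>?G\<^esub> k) = z"
      using that inv_solve_left'[of "\<one>\<^bsub>?G\<^esub>" z "x \<otimes>\<^bsub>?G\<^esub> (z \<otimes>\<^bsub>?G\<^esub> x [^]\<^bsub>?G\<^esub> (- k))"]
      by (simp add: m_assoc int_pow_neg)
    then show ?thesis using that by (simp add: inv_solve_right')
  qed
  have A: "?A \<otimes>\<^bsub>?G\<^esub> ?C = ?C \<otimes>\<^bsub>?G\<^esub> ?A [^]\<^bsub>?G\<^esub> \<alpha>"
  proof (rule conj)
    show "inv\<^bsub>?G\<^esub> ?C \<otimes>\<^bsub>?G\<^esub> (?A \<otimes>\<^bsub>?G\<^esub> (?C \<otimes>\<^bsub>?G\<^esub> ?A [^]\<^bsub>?G\<^esub> (- \<alpha>))) = \<one>\<^bsub>?G\<^esub>"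
      using rel[of "winv (comm_word lA lB) @ [lA] @ comm_word lA lB @ wpow lA (- \<alpha>)"]
      by (simp only: G_rels_def insert_iff app winv wpow simp_thms)
  qed simp_all
  have "?B \<otimes>\<^bsub>?G\<^esub> inv\<^bsub>?G\<^esub> ?C = inv\<^bsub>?G\<^esub> ?C \<otimes>\<^bsub>?G\<^esub> ?B [^]\<^bsub>?G\<^esub> \<beta>"
  proof (rule conj)
    show "inv\<^bsub>?G\<^esub> (inv\<^bsub>?G\<^esub> ?C) \<otimes>\<^bsub>?G\<^esub> (?B \<otimes>\<^bsub>?G\<^esub> (inv\<^bsub>?G\<^esub> ?C \<otimes>\<^bsub>?G\<^esub> ?B [^]\<^bsub>?G\<^esub> (- \<beta>))) = \<one>\<^bsub>?G\<^esub>"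
      using rel[of "winv (comm_word lB lA) @ [lB] @ comm_word lB lA @ wpow lB (- \<beta>)"]
      by (simp only: G_rels_def insert_iff app winv wpow C' simp_thms)
  qed simp_all
  \<comment> \<open>The second relator conjugates by [B,A], the inverse of \<open>?C\<close>;
    inverting the conjugation gives the form required by the locale.\<close>
  then have B: "?C \<otimes>\<^bsub>?G\<^esub> ?B = ?B [^]\<^bsub>?G\<^esub> \<beta> \<otimes>\<^bsub>?G\<^esub> ?C"
    using intertwine_inv[of ?B "?B [^]\<^bsub>?G\<^esub> \<beta>" "inv\<^bsub>?G\<^esub> ?C"] by simp
  have "?C = c ([flip lA] @ [flip lB] @ [lA] @ [lB])" by (simp add: comm_word_def)
  also have "\<dots> = inv\<^bsub>?G\<^esub> ?A \<otimes>\<^bsub>?G\<^esub> (inv\<^bsub>?G\<^esub> ?B \<otimes>\<^bsub>?G\<^esub> (?A \<otimes>\<^bsub>?G\<^esub> ?B))"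
    by (simp only: app flip)
  finally have "?A \<otimes>\<^bsub>?G\<^esub> ?C = inv\<^bsub>?G\<^esub> ?B \<otimes>\<^bsub>?G\<^esub> (?A \<otimes>\<^bsub>?G\<^esub> ?B)"
    by (simp add: inv_solve_left)
  then have AB: "?A \<otimes>\<^bsub>?G\<^esub> ?B = ?B \<otimes>\<^bsub>?G\<^esub> (?A \<otimes>\<^bsub>?G\<^esub> ?C)"
    by (simp only: inv_solve_left closed m_closed)
  have gen: "carrier ?G = generate ?G {?A, ?B}"
    using presented_group_generate by (simp add: c_def G_ab_def)
  show ?thesis by unfold_locales (fact closed A B AB gen)+
qed

theorem theorem3p1:
  fixes \<alpha> \<beta> :: int
  assumes "\<alpha> \<noteq> 1" and "\<beta> \<noteq> 1"
  shows "nilpotent (G_ab \<alpha> \<beta>)"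
  using generated_macdonald.nilpotent_if_ne_one[OF generated_macdonald_G_ab assms] .

end
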